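(* Let $\mathcal{X}\subset\mathbb{R}^n$ be a compact convex set, let $f$ be convex (possibly nonsmooth), let $x^*\in\operatorname{argmin}_{x\in\mathcal{X}}f(x)$, let $R>0$ be such that $\mathcal{X}\subset B(x^*,R)$, and let $L>0$ be such that for every $x\in\mathcal{X}$ the subdifferential $\partial f(x)$ is nonempty and $\|g\|\le L$ for every $g\in\partial f(x)$. Let $(x_s)_{s\ge1}$ be any sequence of iterates of the projected subgradient method started at a point $x_1\in\mathcal{X}$ with step-sizes $\eta_s=\frac{R}{L\sqrt{s}}$, $s\ge 1$. Then for every integer $t\ge1$, $$f\left(\frac{\sum_{s=1}^t x_s}{t}\right)-f(x^* )\le \frac{3RL}{2\sqrt{t}}.$$
   Context: $\|\cdot\|$ is the Euclidean norm on $\mathbb{R}^n$ and $B(x^*,R)$ is the closed Euclidean ball of radius $R$ centered at $x^*$. The function $f$ is a real-valued convex function defined on a convex set $D\subset\mathbb{R}^n$ containing $\mathcal{X}$ (e.g. $D=\mathbb{R}^n$), and $\partial f(x)=\{g\in\mathbb{R}^n: f(y)\ge f(x)+g^T(y-x)\ \text{for all } y\in D\}$ is its subdifferential at $x$. The projected subgradient method with positive step-sizes $(\eta_s)_{s\ge1}$, started at $x_1\in\mathcal{X}$, generates, for $s\ge1$, $$y_{s+1}=x_s-\eta_s g_s,\quad\text{where } g_s\in\partial f(x_s)\text{ is arbitrary},\qquad x_{s+1}=\operatorname{argmin}_{x\in\mathcal{X}}\|x-y_{s+1}\|.$$ *)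

theory Defs
  imports "HOL-Analysis.Analysis"
begin

definition subdifferential ::
    "(real ^ 'n) set \<Rightarrow> (real ^ 'n \<Rightarrow> real) \<Rightarrow> real ^ 'n \<Rightarrow> (real ^ 'n) set" where
  "subdifferential D f x = {g. \<forall>y\<in>D. f y \<ge> f x + g \<bullet> (y - x)}"

text \<open>
  Sequences are indexed from 1; the values at index 0 (and the value of \<open>y\<close> at index 1)
  are irrelevant. The subgradients \<open>g s\<close> are arbitrary elements of the subdifferential,
  so this is a relation on sequences rather than a recursive function.
\<close>

definition projected_subgradient_iterates ::
    "(real ^ 'n) set \<Rightarrow> (real ^ 'n) set \<Rightarrow> (real ^ 'n \<Rightarrow> real) \<Rightarrow>
     (nat \<Rightarrow> real) \<Rightarrow> (nat \<Rightarrow> real ^ 'n) \<Rightarrow> bool" where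
  "projected_subgradient_iterates X D f \<eta> x \<longleftrightarrow>
     (\<forall>s\<ge>1. \<eta> s > 0) \<and> x 1 \<in> X \<and>
     (\<exists>g y. \<forall>s\<ge>1.
        g s \<in> subdifferential D f (x s) \<and>
        y (s + 1) = x s - \<eta> s *\<^sub>R g s \<and>
        is_arg_min (\<lambda>z. norm (z - y (s + 1))) (\<lambda>z. z \<in> X) (x (s + 1)))"

end

theory Submission
  imports Defs
begin

text \<open>
  Write \<open>d s = norm (x s - xstar)\<close>. Since projecting onto \<open>X\<close> does not increase the distance to
  \<open>xstar\<close>, the subgradient inequality gives
  \<open>f (x s) - f xstar \<le> ((d s)\<^sup>2 - (d (s + 1))\<^sup>2) / (2 * \<eta> s) + \<eta> s * L\<^sup>2 / 2\<close>. Summing over \<open>s \<le> t\<close>, summation by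
  parts with \<open>d s \<le> R\<close> bounds the first terms by \<open>R\<^sup>2 / (2 * \<eta> t) = R * L * sqrt t / 2\<close>, and
  \<open>1 / sqrt s \<le> 2 * (sqrt s - sqrt (s - 1))\<close> bounds the others by \<open>R * L * sqrt t\<close>. Jensen's
  inequality passes from the mean of the values to the value at the mean.
\<close>

text \<open>The closest point \<open>p\<close> sees \<open>a\<close> and \<open>z\<close> under an
  angle of at least 90 degrees, so expanding \<open>norm (a - z)\<close> around \<open>p\<close>
  gives \<open>(norm (p - z))\<^sup>2\<close> plus nonnegative terms.\<close>

lemma norm_projection_diff_le:
  fixes a p z :: "'a::euclidean_space"
  assumes "convex S" "closed S" "z \<in> S"
    and p: "is_arg_min (\<lambda>w. norm (w - a)) (\<lambda>w. w \<in> S) p"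
  shows "norm (p - z) \<le> norm (a - z)"
proof -
  have "p \<in> S" and "\<forall>w\<in>S. dist a p \<le> dist a w"
    using p by (auto simp: is_arg_min_linorder dist_norm norm_minus_commute)
  then have le0: "(a - p) \<bullet> (z - p) \<le> 0"
    using any_closest_point_dot assms(1-3) by blast
  have "(norm (a - z))\<^sup>2 = (norm (a - p))\<^sup>2 - 2 * ((a - p) \<bullet> (z - p)) + (norm (p - z))\<^sup>2"
    by (simp add: power2_norm_eq_inner inner_diff inner_commute algebra_simps)
  with le0 have "(norm (p - z))\<^sup>2 \<le> (norm (a - z))\<^sup>2"
    by (smt (verit) zero_le_power2)
  then show ?thesis
    by (rule power2_le_imp_le) simp
qed

text \<open>Expanding the squared distance from \<open>z\<close> after the unprojected step produces
  the cross term \<open>g \<bullet> (u - z)\<close>, which dominates \<open>f u - f z\<close>;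
  projecting onto \<open>X\<close> only shrinks that distance.\<close>

lemma subgradient_step:
  assumes "convex X" "closed X" "z \<in> X" "X \<subseteq> D"
    and "\<eta> > 0" and g: "g \<in> subdifferential D f u" and "norm g \<le> L"
    and v: "is_arg_min (\<lambda>w. norm (w - (u - \<eta> *\<^sub>R g))) (\<lambda>w. w \<in> X) v"
  shows "f u - f z \<le> ((norm (u - z))\<^sup>2 - (norm (v - z))\<^sup>2) / (2 * \<eta>) + \<eta> * L\<^sup>2 / 2"
proof -
  have "f u - f z \<le> g \<bullet> (u - z)"
    using g assms(3,4) by (force simp: subdifferential_def inner_diff_right)
  then have "2 * \<eta> * (f u - f z) \<le> 2 * \<eta> * (g \<bullet> (u - z))"
    using \<open>\<eta> > 0\<close> by simp
  moreover have "(norm (v - z))\<^sup>2 \<le> (norm (u - \<eta> *\<^sub>R g - z))\<^sup>2"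
    using norm_projection_diff_le[OF assms(1-3) v] by (simp add: power_mono)
  moreover have "(norm (u - \<eta> *\<^sub>R g - z))\<^sup>2
      = (norm (u - z))\<^sup>2 - 2 * \<eta> * (g \<bullet> (u - z)) + \<eta>\<^sup>2 * (norm g)\<^sup>2"
    unfolding power2_norm_eq_inner
    by (simp add: inner_diff inner_commute algebra_simps power2_eq_square)
  moreover have "\<eta>\<^sup>2 * (norm g)\<^sup>2 \<le> \<eta>\<^sup>2 * L\<^sup>2"
    using \<open>norm g \<le> L\<close> by (intro mult_left_mono power_mono) auto
  ultimately have "2 * \<eta> * (f u - f z) \<le> (norm (u - z))\<^sup>2 - (norm (v - z))\<^sup>2 + \<eta>\<^sup>2 * L\<^sup>2"
    by linarith
  then show ?thesis
    using \<open>\<eta> > 0\<close> by (simp add: field_simps power2_eq_square)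
qed

text \<open>After multiplication by \<open>sqrt (Suc n)\<close> this is the AM-GM inequality for
  \<open>n + 1\<close> and \<open>n\<close>. The right-hand side telescopes.\<close>

lemma inverse_sqrt_Suc_le:
  "1 / sqrt (real (Suc n)) \<le> 2 * (sqrt (real (Suc n)) - sqrt (real n))"
proof -
  have "2 * (sqrt (real (Suc n)) * sqrt (real n)) \<le> real (Suc n) + real n"
    using sum_squares_bound[of "sqrt (real (Suc n))" "sqrt (real n)"] by simp
  then show ?thesis
    by (simp add: field_simps)
qed

text \<open>The potential term with \<open>d (Suc t)\<close> on the left makes the summation by parts an induction.\<close>

lemma sum_gap_le:
  fixes \<delta> d :: "nat \<Rightarrow> real"
  assumes "R > 0" "L > 0"
    and d: "\<And>s. s \<ge> 1 \<Longrightarrow> 0 \<le> d s \<and> d s \<le> R"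
    and step: "\<And>s. s \<ge> 1 \<Longrightarrow> \<delta> s \<le> L * sqrt (real s) / (2 * R) * ((d s)\<^sup>2 - (d (Suc s))\<^sup>2)
      + R * L / (2 * sqrt (real s))"
  shows "(\<Sum>s=1..t. \<delta> s) + L * sqrt (real t) / (2 * R) * (d (Suc t))\<^sup>2 \<le> 3 / 2 * R * L * sqrt (real t)"
proof (induction t)
  \<comment> \<open>The potential has weight \<open>sqrt 0 = 0\<close> here, so both sides
    vanish.\<close>
  case 0
  then show ?case by simp
next
  case (Suc t)
  let ?a = "sqrt (real t)" and ?b = "sqrt (real (Suc t))"
  \<comment> \<open>The induction hypothesis weights the potential with \<open>?a\<close>, the new
    step with \<open>?b\<close>; the bound \<open>R\<close> controls the cost of raising the
    weight.\<close>
  have "(d (Suc t))\<^sup>2 \<le> R\<^sup>2"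
    using d[of "Suc t"] by (simp add: power_mono)
  then have "L * (?b - ?a) / (2 * R) * (d (Suc t))\<^sup>2 \<le> L * (?b - ?a) / (2 * R) * R\<^sup>2"
    using assms(1,2) by (intro mult_left_mono) auto
  also have "\<dots> = R * L * (?b - ?a) / 2"
    using assms(1) by (simp add: power2_eq_square)
  finally have 1: "L * (?b - ?a) / (2 * R) * (d (Suc t))\<^sup>2 \<le> R * L * (?b - ?a) / 2" .
  have "R * L / (2 * ?b) = R * L / 2 * (1 / ?b)"
    by simp
  also have "\<dots> \<le> R * L / 2 * (2 * (?b - ?a))"
    using assms(1,2) by (intro mult_left_mono inverse_sqrt_Suc_le) auto
  also have "\<dots> = R * L * (?b - ?a)"
    by (simp add: algebra_simps)
  finally have 2: "R * L / (2 * ?b) \<le> R * L * (?b - ?a)" .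
  have 3: "\<delta> (Suc t) \<le> L * ?b / (2 * R) * ((d (Suc t))\<^sup>2 - (d (Suc (Suc t)))\<^sup>2) + R * L / (2 * ?b)"
    using step[of "Suc t"] by simp
  have "(\<Sum>s=1..Suc t. \<delta> s) + L * ?b / (2 * R) * (d (Suc (Suc t)))\<^sup>2
      \<le> (\<Sum>s=1..t. \<delta> s) + L * ?b / (2 * R) * (d (Suc t))\<^sup>2 + R * L / (2 * ?b)"
    using 3 by (simp add: right_diff_distrib)
  also have "\<dots> = ((\<Sum>s=1..t. \<delta> s) + L * ?a / (2 * R) * (d (Suc t))\<^sup>2)
      + L * (?b - ?a) / (2 * R) * (d (Suc t))\<^sup>2 + R * L / (2 * ?b)"
    by (simp add: right_diff_distrib left_diff_distrib diff_divide_distrib)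
  \<comment> \<open>The constant is \<open>3/2 = 1/2 + 1\<close>: one half from the change of
    weight, one from the step-size term.\<close>
  also have "\<dots> \<le> 3 / 2 * R * L * ?a + R * L * (?b - ?a) / 2 + R * L * (?b - ?a)"
    using Suc.IH 1 2 by linarith
  also have "\<dots> = 3 / 2 * R * L * ?b"
    by (simp add: field_simps)
  finally show ?case .
qed

theorem theorem1:
  fixes X D :: "(real ^ 'n) set"
    and f :: "real ^ 'n \<Rightarrow> real"
    and xstar :: "real ^ 'n"
    and x :: "nat \<Rightarrow> real ^ 'n"
    and R L :: real
    and t :: nat
  assumes "compact X" and "convex X"
    and "convex D" and "X \<subseteq> D" and "convex_on D f"
    and "is_arg_min f (\<lambda>z. z \<in> X) xstar"
    and "R > 0" and "X \<subseteq> cball xstar R"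
    and "L > 0"
    and "\<And>z. z \<in> X \<Longrightarrow> subdifferential D f z \<noteq> {}"
    and "\<And>z g. z \<in> X \<Longrightarrow> g \<in> subdifferential D f z \<Longrightarrow> norm g \<le> L"
    and "projected_subgradient_iterates X D f (\<lambda>s. R / (L * sqrt (real s))) x"
    and "t \<ge> 1"
  shows "f ((\<Sum>s=1..t. x s) /\<^sub>R real t) - f xstar \<le> 3 * R * L / (2 * sqrt (real t))"
proof -
  let ?\<eta> = "\<lambda>s. R / (L * sqrt (real s))"
  have xstar: "xstar \<in> X"
    using assms(6) by (simp add: is_arg_min_linorder)
  obtain g y where x1: "x 1 \<in> X"
    and it: "\<And>s. s \<ge> 1 \<Longrightarrow> g s \<in> subdifferential D f (x s)"
      "\<And>s. s \<ge> 1 \<Longrightarrow> y (s + 1) = x s - ?\<eta> s *\<^sub>R g s"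
      "\<And>s. s \<ge> 1 \<Longrightarrow> is_arg_min (\<lambda>z. norm (z - y (s + 1))) (\<lambda>z. z \<in> X) (x (s + 1))"
    using assms(12) unfolding projected_subgradient_iterates_def by blast
  have xX: "x s \<in> X" if "s \<ge> 1" for s
    using that
  proof (induction s rule: dec_induct)
    case (step s)
    then show ?case using it(3)[of s] by (simp add: is_arg_min_linorder)
  qed (rule x1)
  define \<delta> where "\<delta> s = f (x s) - f xstar" for s
  have step: "\<delta> s \<le> L * sqrt (real s) / (2 * R) * ((norm (x s - xstar))\<^sup>2 - (norm (x (Suc s) - xstar))\<^sup>2)
      + R * L / (2 * sqrt (real s))" if "s \<ge> 1" for s
  proof -
    have "\<delta> s \<le> ((norm (x s - xstar))\<^sup>2 - (norm (x (Suc s) - xstar))\<^sup>2) / (2 * ?\<eta> s) + ?\<eta> s * L\<^sup>2 / 2"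
      unfolding \<delta>_def
    proof (rule subgradient_step[where g = "g s" and D = D])
      show "is_arg_min (\<lambda>w. norm (w - (x s - ?\<eta> s *\<^sub>R g s))) (\<lambda>w. w \<in> X) (x (Suc s))"
        using it(2,3)[OF that] by simp
    qed (use assms that xstar it(1) xX compact_imp_closed assms(11)[OF xX it(1)] in auto)
    \<comment> \<open>With this step-size, \<open>1 / (2 * ?\<eta> s)\<close> is
      \<open>L * sqrt s / (2 * R)\<close> and \<open>?\<eta> s * L\<^sup>2 / 2\<close> is
      \<open>R * L / (2 * sqrt s)\<close>.\<close>
    also have "\<dots> = L * sqrt (real s) / (2 * R) * ((norm (x s - xstar))\<^sup>2 - (norm (x (Suc s) - xstar))\<^sup>2)
      + R * L / (2 * sqrt (real s))"
      using assms(7,9) that by (simp add: power2_eq_square field_simps)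
    finally show ?thesis .
  qed
  have "0 \<le> norm (x s - xstar) \<and> norm (x s - xstar) \<le> R" if "s \<ge> 1" for s
    using xX[OF that] assms(8) by (auto simp: dist_norm norm_minus_commute)
  from sum_gap_le[where d = "\<lambda>s. norm (x s - xstar)", OF assms(7,9) this step]
  have "(\<Sum>s=1..t. \<delta> s) + L * sqrt (real t) / (2 * R) * (norm (x (Suc t) - xstar))\<^sup>2
      \<le> 3 / 2 * R * L * sqrt (real t)" .
  moreover have "0 \<le> L * sqrt (real t) / (2 * R) * (norm (x (Suc t) - xstar))\<^sup>2"
    using assms(7,9) by simp
  ultimately have sum: "(\<Sum>s=1..t. \<delta> s) \<le> 3 / 2 * R * L * sqrt (real t)"
    by linarith
  \<comment> \<open>Jensen's inequality with equal weights; \<open>t \<ge> 1\<close> makes them sum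
    to 1, and the iterates lie in \<open>X \<subseteq> D\<close>.\<close>
  have "f (\<Sum>s=1..t. (1 / real t) *\<^sub>R x s) \<le> (\<Sum>s=1..t. (1 / real t) * f (x s))"
    by (rule convex_on_sum[OF _ _ assms(5)]) (use assms(4,13) xX in auto)
  also have "\<dots> = f xstar + (\<Sum>s=1..t. \<delta> s) / real t"
    using assms(13) by (simp add: \<delta>_def sum_subtractf sum_divide_distrib [symmetric] field_simps)
  finally have "f ((\<Sum>s=1..t. x s) /\<^sub>R real t) - f xstar \<le> (\<Sum>s=1..t. \<delta> s) / real t"
    by (simp add: scaleR_sum_right inverse_eq_divide)
  also have "\<dots> \<le> 3 / 2 * R * L * sqrt (real t) / real t"
    using sum by (rule divide_right_mono) simp
  also have "\<dots> = 3 * R * L / (2 * sqrt (real t))"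
    using real_div_sqrt[of "real t"] assms(13) by (simp add: field_simps)
  finally show ?thesis .
qed

end
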